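(* Let $\lambda>0$ and let $b:\mathbb{R}\to\mathbb{R}^+$ be a continuous function satisfying $0<b_0\le b(t)\le b_1$ for all $t\in\mathbb{R}$ and $b(t)\to b_\infty\in[b_0,b_1]$ as $t\to+\infty$. Let $\mathcal{A}=\{\mathcal{A}(t)\}_{t\in\mathbb{R}}$ be the pullback attractor of the multivalued process $U$ on $\mathbb{R}$ generated by all solutions of the differential inclusion $$\frac{du}{dt}+\lambda u\in b(t)H_0(u),\ t\ge\tau,\qquad u(\tau)=u_\tau,$$ where $H_0(u)=\{1\}$ if $u>0$, $H_0(0)=[-1,1]$, $H_0(u)=\{-1\}$ if $u<0$. Let $\mathcal{A}_\infty$ be the global attractor of the multivalued semiflow $G$ generated by all solutions (with $\tau=0$) of the autonomous inclusion in which $b(t)$ is replaced by the constant $b_\infty$. Then $$\lim_{t\to+\infty}dist_H(\mathcal{A}(t),\mathcal{A}_\infty)=0.$$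
   Context: A solution on $[\tau,\infty)$ is a function $u\in C([\tau,\infty),\mathbb{R})$ with $\frac{du}{dt}\in L^\infty_{loc}([\tau,\infty),\mathbb{R})$ for which there is $h\in L^\infty_{loc}([\tau,\infty),\mathbb{R})$ with $h(t)\in H_0(u(t))$ and $\frac{du}{dt}+\lambda u=b(t)h(t)$ for a.a. $t\ge\tau$. $U(t,\tau,x)$ is the set of values $u(t)$ of all solutions on $[\tau,\infty)$ with $u(\tau)=x$; $G(t,x)$ is the set of values $u(t)$ of all solutions on $[0,\infty)$ of the autonomous inclusion with $u(0)=x$. Images of sets are unions of images of points. $dist(A,B)=\sup_{y\in A}\inf_{x\in B}|y-x|$, $dist_H(A,B)=\max\{dist(A,B),dist(B,A)\}$. The pullback attractor is the family of non-empty compact negatively invariant sets ($\mathcal{A}(t)\subset U(t,s,\mathcal{A}(s))$ for $t\ge s$) which is the minimal family of closed sets satisfying $dist(U(t,t_0,B),\mathcal{A}(t))\to0$ as $t_0\to-\infty$ for every bounded $B\subset\mathbb{R}$ and every fixed $t$. The global attractor of $G$ is the compact set with $\mathcal{A}_\infty\subset G(t,\mathcal{A}_\infty)$ for $t\ge0$ and $dist(G(t,B),\mathcal{A}_\infty)\to0$ as $t\to+\infty$ for every bounded $B$. Both are known to exist, with $\mathcal{A}(t)=[\xi_M^-(t),\xi_M^+(t)]$, $\xi_M^{\pm}(t)=\pm\int_{-\infty}^te^{-\lambda(t-s)}b(s)\,ds$, and $\mathcal{A}_\infty=[-\frac{b_\infty}{\lambda},\frac{b_\infty}{\lambda}]$.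 *)

theory Defs
  imports "HOL-Analysis.Analysis"
begin

section \<open>Solutions of the differential inclusion\<close>

definition H0 :: "real \<Rightarrow> real set" where
  "H0 u = (if u > 0 then {1} else if u = 0 then {-1..1} else {-1})"

definition Linf_loc :: "real \<Rightarrow> (real \<Rightarrow> real) \<Rightarrow> bool" where
  "Linf_loc \<tau> f \<longleftrightarrow>
     f \<in> borel_measurable (lebesgue_on {\<tau>..}) \<and>
     (\<forall>K. compact K \<and> K \<subseteq> {\<tau>..} \<longrightarrow> (\<exists>C. AE t in lebesgue_on K. \<bar>f t\<bar> \<le> C))"

definition abs_continuous_on :: "real set \<Rightarrow> (real \<Rightarrow> real) \<Rightarrow> bool" where
  "abs_continuous_on S u \<longleftrightarrow>
     (\<forall>\<epsilon>>0. \<exists>\<delta>>0. \<forall>d T. d division_of T \<and> T \<subseteq> S \<and> (\<Sum>k\<in>d. measure lborel k) < \<delta>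
        \<longrightarrow> (\<Sum>k\<in>d. \<bar>u (Sup k) - u (Inf k)\<bar>) < \<epsilon>)"

text \<open>
  Existence of the derivative almost everywhere would not suffice to say that the time derivative
  is a locally bounded function: it has to be accompanied by local absolute continuity, which
  excludes singular functions such as the Cantor function.
\<close>

definition has_Linf_loc_deriv :: "real \<Rightarrow> (real \<Rightarrow> real) \<Rightarrow> (real \<Rightarrow> real) \<Rightarrow> bool" where
  "has_Linf_loc_deriv \<tau> u v \<longleftrightarrow>
     (\<forall>T\<ge>\<tau>. abs_continuous_on {\<tau>..T} u) \<and> Linf_loc \<tau> v \<and>
     (AE t in lebesgue_on {\<tau>..}. (u has_real_derivative v t) (at t))"

text \<open>Functions on \<open>[\<tau>,\<infinity>)\<close> are total functions whose values before \<open>\<tau>\<close> are irrelevant.\<close>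

definition is_solution :: "real \<Rightarrow> (real \<Rightarrow> real) \<Rightarrow> real \<Rightarrow> (real \<Rightarrow> real) \<Rightarrow> bool" where
  "is_solution lam b \<tau> u \<longleftrightarrow>
     continuous_on {\<tau>..} u \<and>
     (\<exists>v h. has_Linf_loc_deriv \<tau> u v \<and> Linf_loc \<tau> h \<and>
        (AE t in lebesgue_on {\<tau>..}. h t \<in> H0 (u t) \<and> v t + lam * u t = b t * h t))"

text \<open>The process is meaningful for \<open>t \<ge> \<tau>\<close> only, the semiflow for \<open>t \<ge> 0\<close> only.\<close>

definition process :: "real \<Rightarrow> (real \<Rightarrow> real) \<Rightarrow> real \<Rightarrow> real \<Rightarrow> real \<Rightarrow> real set" where
  "process lam b t \<tau> x = {u t | u. is_solution lam b \<tau> u \<and> u \<tau> = x}"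

definition semiflow :: "real \<Rightarrow> real \<Rightarrow> real \<Rightarrow> real \<Rightarrow> real set" where
  "semiflow lam \<beta> t x = {u t | u. is_solution lam (\<lambda>_. \<beta>) 0 u \<and> u 0 = x}"

section \<open>Attractors\<close>

text \<open>
  Over the extended nonnegative reals the supremum over the empty set is \<open>0\<close>, the infimum over the
  empty set is \<open>\<infinity>\<close>, and the semidistance of an unbounded set to a bounded one is \<open>\<infinity>\<close>.
\<close>

definition semidist :: "real set \<Rightarrow> real set \<Rightarrow> ennreal" where
  "semidist A B = (SUP y\<in>A. INF x\<in>B. ennreal \<bar>y - x\<bar>)"

definition hausdorff_dist :: "real set \<Rightarrow> real set \<Rightarrow> ennreal" where
  "hausdorff_dist A B = max (semidist A B) (semidist B A)"

definition pullback_attracting ::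
    "(real \<Rightarrow> real \<Rightarrow> real \<Rightarrow> real set) \<Rightarrow> (real \<Rightarrow> real set) \<Rightarrow> bool" where
  "pullback_attracting U K \<longleftrightarrow>
     (\<forall>B t. bounded B \<longrightarrow> ((\<lambda>t0. semidist (\<Union>x\<in>B. U t t0 x) (K t)) \<longlongrightarrow> 0) at_bot)"

definition is_pullback_attractor ::
    "(real \<Rightarrow> real \<Rightarrow> real \<Rightarrow> real set) \<Rightarrow> (real \<Rightarrow> real set) \<Rightarrow> bool" where
  "is_pullback_attractor U A \<longleftrightarrow>
     (\<forall>t. A t \<noteq> {} \<and> compact (A t)) \<and>
     (\<forall>s t. s \<le> t \<longrightarrow> A t \<subseteq> (\<Union>x\<in>A s. U t s x)) \<and>
     pullback_attracting U A \<and>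
     (\<forall>C. (\<forall>t. closed (C t)) \<and> pullback_attracting U C \<longrightarrow> (\<forall>t. A t \<subseteq> C t))"

definition is_global_attractor :: "(real \<Rightarrow> real \<Rightarrow> real set) \<Rightarrow> real set \<Rightarrow> bool" where
  "is_global_attractor G A \<longleftrightarrow>
     compact A \<and>
     (\<forall>t\<ge>0. A \<subseteq> (\<Union>x\<in>A. G t x)) \<and>
     (\<forall>B. bounded B \<longrightarrow> ((\<lambda>t. semidist (\<Union>x\<in>B. G t x) A) \<longlongrightarrow> 0) at_top)"

end

theory Submission
  imports Defs
begin

text \<open>
  Let \<open>P\<close> be the primitive of \<open>t \<mapsto> exp (\<lambda>t) b(t)\<close> vanishing at \<open>-\<infinity>\<close>, so that
  \<open>\<xi>(t) = exp (-\<lambda>t) P(t)\<close> is the bounded solution of \<open>\<xi>' + \<lambda>\<xi> = b\<close>. Every solution satisfies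
  \<open>\<bar>exp (\<lambda>t) u(t) - exp (\<lambda>\<tau>) u(\<tau>)\<bar> \<le> P(t) - P(\<tau>)\<close>, hence \<open>[-\<xi>(t), \<xi>(t)]\<close> is pullback attracting and
  contains \<open>A(t)\<close> by minimality. Conversely, a solution starting at \<open>0\<close> may stay there until an arbitrary
  time \<open>s\<^sub>0\<close> and then leave with either sign; choosing \<open>s\<^sub>0\<close> suitably reaches every point of
  \<open>(-\<xi>(t), \<xi>(t))\<close> at time \<open>t\<close> from every sufficiently early initial time, so attraction and
  closedness give \<open>A(t) = [-\<xi>(t), \<xi>(t)]\<close>. The same two arguments with constant \<open>b\<close> identify the
  global attractor, and \<open>\<xi>(t) \<rightarrow> b\<^sub>\<infinity>/\<lambda>\<close> by l'Hospital's rule.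
\<close>

section \<open>Absolute continuity by comparison of increments\<close>

text \<open>Summed over a division, the increments of \<open>f\<close> are at most \<open>M\<close>
  times the variation of \<open>u\<close> plus \<open>L\<close> times the total length, and both
  become small with the length. This transfers absolute continuity from a solution to its
  exponentially weighted combinations with \<open>P\<close>.\<close>

lemma abs_continuous_on_dominated:
  assumes u: "abs_continuous_on S u" and "M \<ge> 0" "L \<ge> 0"
    and le: "\<And>x y. x \<in> S \<Longrightarrow> y \<in> S \<Longrightarrow> x \<le> y \<Longrightarrow> \<bar>f y - f x\<bar> \<le> M * \<bar>u y - u x\<bar> + L * (y - x)"
  shows "abs_continuous_on S f"
  unfolding abs_continuous_on_def
proof (intro allI impI)
  fix \<epsilon> :: real assume \<epsilon>: "\<epsilon> > 0"
  \<comment> \<open>Each of the two terms gets half of \<open>\<epsilon>\<close>. Dividing by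
    \<open>M + 1\<close> and \<open>L + 1\<close> avoids zero denominators and leaves room for the
    strict inequality.\<close>
  define e where "e = \<epsilon> / (2 * (M + 1))"
  have "e > 0" using \<epsilon> \<open>M \<ge> 0\<close> by (simp add: e_def)
  then obtain \<delta> where \<delta>: "\<delta> > 0" and
    AC: "\<And>d T. d division_of T \<Longrightarrow> T \<subseteq> S \<Longrightarrow> (\<Sum>k\<in>d. measure lborel k) < \<delta>
        \<Longrightarrow> (\<Sum>k\<in>d. \<bar>u (Sup k) - u (Inf k)\<bar>) < e"
    using u unfolding abs_continuous_on_def by meson
  define \<eta> where "\<eta> = min \<delta> (\<epsilon> / (2 * (L + 1)))"
  have "\<eta> > 0" using \<epsilon> \<delta> \<open>L \<ge> 0\<close> by (simp add: \<eta>_def)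
  moreover have "(\<Sum>k\<in>d. \<bar>f (Sup k) - f (Inf k)\<bar>) < \<epsilon>"
    if d: "d division_of T" "T \<subseteq> S" and small: "(\<Sum>k\<in>d. measure lborel k) < \<eta>" for d T
  proof -
    have each: "\<bar>f (Sup k) - f (Inf k)\<bar> \<le> M * \<bar>u (Sup k) - u (Inf k)\<bar> + L * measure lborel k" if "k \<in> d" for k
    proof -
      have "k \<noteq> {}" "k \<subseteq> T" using division_ofD(2,3)[OF d(1) that] by auto
      moreover have "\<exists>l r. k = {l..r}"
        using division_ofD(4)[OF d(1) that] by auto
      then obtain l r where "k = {l..r}" by blast
      ultimately have "l \<le> r" "l \<in> S" "r \<in> S" using d(2) by auto
      then show ?thesis using le[of l r] \<open>k = {l..r}\<close> by simp
    qed
    have "(\<Sum>k\<in>d. \<bar>f (Sup k) - f (Inf k)\<bar>)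
        \<le> M * (\<Sum>k\<in>d. \<bar>u (Sup k) - u (Inf k)\<bar>) + L * (\<Sum>k\<in>d. measure lborel k)"
      using sum_mono[OF each] by (simp add: sum.distrib sum_distrib_left)
    also have "\<dots> \<le> M * e + L * (\<epsilon> / (2 * (L + 1)))"
      using AC[OF d] small \<open>M \<ge> 0\<close> \<open>L \<ge> 0\<close> by (intro add_mono mult_left_mono) (auto simp: \<eta>_def)
    also have "\<dots> < (M + 1) * e + (L + 1) * (\<epsilon> / (2 * (L + 1)))"
      using \<open>e > 0\<close> \<epsilon> \<open>L \<ge> 0\<close> by (intro add_strict_mono mult_strict_right_mono) auto
    also have "(M + 1) * e = \<epsilon> / 2" using \<open>M \<ge> 0\<close> by (simp add: e_def field_simps)
    also have "(L + 1) * (\<epsilon> / (2 * (L + 1))) = \<epsilon> / 2" using \<open>L \<ge> 0\<close> by (simp add: field_simps)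
    finally show ?thesis by simp
  qed
  ultimately show "\<exists>\<delta>>0. \<forall>d T. d division_of T \<and> T \<subseteq> S \<and> (\<Sum>k\<in>d. measure lborel k) < \<delta>
        \<longrightarrow> (\<Sum>k\<in>d. \<bar>f (Sup k) - f (Inf k)\<bar>) < \<epsilon>" by blast
qed

lemma lipschitz_imp_abs_continuous_on:
  assumes "L \<ge> 0" "\<And>x y. x \<in> S \<Longrightarrow> y \<in> S \<Longrightarrow> x \<le> y \<Longrightarrow> \<bar>f y - f x\<bar> \<le> L * (y - x)"
  shows "abs_continuous_on S f"
\<comment> \<open>A constant comparison function has no variation, so only the length term
  remains.\<close>
proof (rule abs_continuous_on_dominated)
  show "abs_continuous_on S (\<lambda>_. 0)"
    unfolding abs_continuous_on_def by (auto intro: exI[of _ 1])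
qed (use assms in \<open>auto intro: order_trans\<close>)

section \<open>Monotonicity from an almost everywhere nonnegative derivative\<close>

text \<open>A one-sided straddle lemma: after splitting at \<open>t\<close>, the linear parts add up
  to \<open>d * (y - x) \<ge> 0\<close> and the two remainders to at most
  \<open>\<epsilon> * (y - x)\<close>.\<close>

lemma increment_ge_of_deriv_nonneg:
  fixes u :: "real \<Rightarrow> real"
  assumes "(u has_real_derivative d) (at t)" "d \<ge> 0" "\<epsilon> > 0"
  shows "\<exists>r>0. \<forall>x y. x \<le> t \<and> t \<le> y \<and> x \<in> ball t r \<and> y \<in> ball t r \<longrightarrow> - \<epsilon> * (y - x) \<le> u y - u x"
proof -
  obtain r where "r > 0" and r: "\<And>y. \<bar>y - t\<bar> < r \<Longrightarrow> \<bar>u y - u t - (y - t) * d\<bar> \<le> \<epsilon> * \<bar>y - t\<bar>"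
    using assms(1)[THEN has_field_derivative_imp_has_derivative] \<open>\<epsilon> > 0\<close>
    unfolding has_derivative_at_alt by (auto simp: mult.commute)
  have "- \<epsilon> * (y - x) \<le> u y - u x"
    if "x \<le> t" "t \<le> y" "x \<in> ball t r" "y \<in> ball t r" for x y
  proof -
    have "\<bar>u y - u t - (y - t) * d\<bar> \<le> \<epsilon> * (y - t)" "\<bar>u x - u t - (x - t) * d\<bar> \<le> \<epsilon> * (t - x)"
      using r[of y] r[of x] that by (auto simp: dist_real_def)
    moreover have "(y - t) * d \<ge> 0" "(x - t) * d \<le> 0"
      using that \<open>d \<ge> 0\<close> by (auto simp: mult_nonpos_nonneg)
    ultimately show ?thesis by (simp add: algebra_simps)
  qed
  then show ?thesis using \<open>r > 0\<close> by blast
qed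

text \<open>
  Cousin's lemma in place of a Vitali covering: the gauge keeps intervals tagged in the exceptional
  null set inside an open set of small measure, where absolute continuity controls the increments.
\<close>

lemma abs_continuous_on_deriv_nonneg_imp_le:
  fixes u :: "real \<Rightarrow> real"
  assumes "a \<le> b" and ac: "abs_continuous_on {a..b} u"
    and deriv: "AE t in lebesgue_on {a..b}. \<exists>d\<ge>0. (u has_real_derivative d) (at t)"
  shows "u a \<le> u b"
proof (rule field_le_epsilon)
  fix e :: real assume "e > 0"
  \<comment> \<open>One half of \<open>e\<close> pays for the intervals with good tags, of total
    length at most \<open>b - a\<close>, the other for the variation over those tagged in
    \<open>N\<close>. The summand 1 covers \<open>a = b\<close>.\<close>
  define \<epsilon> where "\<epsilon> = e / (2 * (b - a + 1))"
  have "\<epsilon> > 0" using \<open>e > 0\<close> \<open>a \<le> b\<close> by (simp add: \<epsilon>_def)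
  obtain \<delta> where "\<delta> > 0" and
    AC: "\<And>d T. d division_of T \<Longrightarrow> T \<subseteq> {a..b} \<Longrightarrow> (\<Sum>k\<in>d. measure lborel k) < \<delta>
        \<Longrightarrow> (\<Sum>k\<in>d. \<bar>u (Sup k) - u (Inf k)\<bar>) < e / 2"
    using ac \<open>e > 0\<close> unfolding abs_continuous_on_def by (meson half_gt_zero)
  have "AE t in lebesgue. t \<in> {a..b} \<longrightarrow> (\<exists>d\<ge>0. (u has_real_derivative d) (at t))"
    using deriv by (subst (asm) AE_restrict_space_iff) auto
  then obtain N where N: "N \<in> null_sets lebesgue"
    and sub: "{t. \<not> (t \<in> {a..b} \<longrightarrow> (\<exists>d\<ge>0. (u has_real_derivative d) (at t)))} \<subseteq> N"
    unfolding eventually_ae_filter by auto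
  have good: "\<exists>d\<ge>0. (u has_real_derivative d) (at t)" if "t \<in> {a..b}" "t \<notin> N" for t
  proof (rule ccontr)
    assume "\<not> ?thesis"
    then have "t \<in> N" using that(1) by (intro subsetD[OF sub]) simp
    then show False using that(2) by simp
  qed
  obtain Q where Q: "open Q" "N \<subseteq> Q" "emeasure lebesgue (Q - N) < ennreal \<delta>"
    using sets_lebesgue_outer_open[OF null_setsD2[OF N] \<open>\<delta> > 0\<close>] by metis
  have "emeasure lebesgue Q = emeasure lebesgue (Q - N)"
    using N Q(1) by (intro emeasure_Diff_null_set[symmetric]) auto
  then have emQ: "emeasure lebesgue Q < ennreal \<delta>" using Q(3) by simp
  then have Qm: "Q \<in> lmeasurable"
    using Q(1) by (intro fmeasurableI) (auto simp: less_top[symmetric])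
  have mQ: "measure lebesgue Q < \<delta>"
    using emQ emeasure_eq_measure2[OF Qm] \<open>\<delta> > 0\<close> by (simp add: ennreal_less_iff)
  have "\<exists>r>0. (t \<in> N \<longrightarrow> ball t r \<subseteq> Q) \<and> (t \<in> {a..b} - N \<longrightarrow>
      (\<forall>x y. x \<le> t \<and> t \<le> y \<and> x \<in> ball t r \<and> y \<in> ball t r \<longrightarrow> - \<epsilon> * (y - x) \<le> u y - u x))" for t
  proof (cases "t \<in> N")
    case True
    then show ?thesis using Q open_contains_ball by blast
  next
    case False
    show ?thesis
    proof (cases "t \<in> {a..b}")
      case True
      then show ?thesis
        using good False increment_ge_of_deriv_nonneg[OF _ _ \<open>\<epsilon> > 0\<close>] by meson
    qed (use False in \<open>auto intro: exI[of _ 1]\<close>)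
  qed
  then obtain r where r: "\<And>t. r t > 0" "\<And>t. t \<in> N \<Longrightarrow> ball t (r t) \<subseteq> Q"
    "\<And>t x y. t \<in> {a..b} - N \<Longrightarrow> x \<le> t \<Longrightarrow> t \<le> y \<Longrightarrow> x \<in> ball t (r t) \<Longrightarrow> y \<in> ball t (r t)
        \<Longrightarrow> - \<epsilon> * (y - x) \<le> u y - u x"
    by metis
  have "gauge (\<lambda>t. ball t (r t))" using r(1) by (auto simp: gauge_def)
  then obtain p where p: "p tagged_division_of {a..b}" and fine: "(\<lambda>t. ball t (r t)) fine p"
    using fine_division_exists_real by blast
  note pD = tagged_division_ofD[OF p]
  have ivl: "\<exists>l r. k = {l..r} \<and> l \<le> t \<and> t \<le> r" if "(t, k) \<in> p" for t k
    using pD(2,4)[OF that] by auto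
  \<comment> \<open>An interval of \<open>p1\<close> loses at most \<open>\<epsilon>\<close> times
    its length. The intervals of \<open>p2\<close> do not overlap and lie in \<open>Q\<close>, so
    their total length is below \<open>\<delta>\<close>.\<close>
  define p1 p2 where "p1 = {z \<in> p. fst z \<notin> N}" and "p2 = {z \<in> p. fst z \<in> N}"
  have fin: "finite p1" "finite p2" using pD(1) by (auto simp: p1_def p2_def)
  have c1: "(\<Sum>(t,k)\<in>p1. - \<epsilon> * measure lborel k) \<le> (\<Sum>(t,k)\<in>p1. u (Sup k) - u (Inf k))"
  proof (rule sum_mono, clarify)
    fix t k assume "(t, k) \<in> p1"
    then have tk: "(t, k) \<in> p" "t \<in> {a..b} - N" using tag_in_interval[OF p] by (auto simp: p1_def)
    obtain l s where lr: "k = {l..s}" "l \<le> t" "t \<le> s" using ivl tk by blast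
    moreover have "l \<in> ball t (r t)" "s \<in> ball t (r t)"
      using subsetD[OF fineD[OF fine tk(1)]] lr by simp_all
    ultimately show "- \<epsilon> * measure lborel k \<le> u (Sup k) - u (Inf k)"
      using r(3)[OF tk(2), of l s] by simp
  qed
  have "(\<Sum>(t,k)\<in>p1. measure lborel k) \<le> (\<Sum>(t,k)\<in>p. measure lborel k)"
    using pD(1) by (intro sum_mono2) (auto simp: p1_def)
  moreover have "(\<Sum>(t,k)\<in>p. measure lborel k) = b - a"
    using additive_content_tagged_division[of p a b] p \<open>a \<le> b\<close> by simp
  ultimately have "\<epsilon> * (\<Sum>(t,k)\<in>p1. measure lborel k) \<le> \<epsilon> * (b - a)"
    using \<open>\<epsilon> > 0\<close> by (intro mult_left_mono) simp_all
  moreover have "(\<Sum>(t,k)\<in>p1. - \<epsilon> * measure lborel k) = - (\<epsilon> * (\<Sum>(t,k)\<in>p1. measure lborel k))"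
    by (simp add: sum_negf sum_distrib_left case_prod_unfold)
  ultimately have "- (\<epsilon> * (b - a)) \<le> (\<Sum>(t,k)\<in>p1. - \<epsilon> * measure lborel k)" by simp
  then have s1: "- (\<epsilon> * (b - a)) \<le> (\<Sum>(t,k)\<in>p1. u (Sup k) - u (Inf k))"
    using c1 by (rule order_trans)
  have p2: "p2 tagged_partial_division_of {a..b}"
  proof (rule tagged_partial_division_subset)
    show "p tagged_partial_division_of {a..b}" using p unfolding tagged_division_of_def by blast
  qed (simp add: p2_def)
  note div = partial_division_of_tagged_division[OF p2]
  \<comment> \<open>Absolute continuity speaks of divisions without tags. Two tags can share only an
    interval with empty interior, so passing to untagged intervals is harmless for a function
    vanishing on every degenerate interval; the value 0 at \<open>{}\<close> ensures this there
    too.\<close>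
  let ?V = "\<lambda>k. if k = {} then 0 else \<bar>u (Sup k) - u (Inf k)\<bar>"
  have sub: "\<Union>(snd ` p2) \<subseteq> Q"
  proof clarify
    fix x t k assume "(t, k) \<in> p2" "x \<in> snd (t, k)"
    then have "(t, k) \<in> p" "t \<in> N" "x \<in> k" by (simp_all add: p2_def)
    then show "x \<in> Q" using fineD[OF fine] r(2) by blast
  qed
  have "(\<Sum>k\<in>snd ` p2. measure lborel k) = (\<Sum>k\<in>snd ` p2. measure lebesgue k)"
  proof (rule sum.cong[OF refl])
    fix k assume "k \<in> snd ` p2"
    then obtain l s where "k = cbox l s" using division_ofD(4)[OF div] by blast
    then show "measure lborel k = measure lebesgue k" by simp
  qed
  also have "\<dots> = measure lebesgue (\<Union>(snd ` p2))"
    by (rule content_division[OF div])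
  also have "\<dots> \<le> measure lebesgue Q"
    by (rule measure_mono_fmeasurable[OF sub fmeasurableD[OF lmeasurable_division[OF div]] Qm])
  finally have "(\<Sum>k\<in>snd ` p2. measure lborel k) < \<delta>" using mQ by simp
  moreover have "\<Union>(snd ` p2) \<subseteq> {a..b}" using tagged_partial_division_ofD(3)[OF p2] by fastforce
  ultimately have variation: "(\<Sum>k\<in>snd ` p2. \<bar>u (Sup k) - u (Inf k)\<bar>) < e / 2"
    using AC[OF div] by blast
  have "(\<Sum>(t,k)\<in>p2. ?V k) = sum ?V (snd ` p2)"
  proof (rule sum.over_tagged_division_lemma[OF tagged_partial_division_of_Union_self[OF p2]])
    fix l s :: real assume "box l s = {}"
    then have "s \<le> l" by simp
    then show "?V (cbox l s) = 0" by (cases "s = l") simp_all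
  qed
  also have "\<dots> = (\<Sum>k\<in>snd ` p2. \<bar>u (Sup k) - u (Inf k)\<bar>)"
    by (rule sum.cong[OF refl]) (simp add: division_ofD(3)[OF div])
  also note variation
  finally have "- (e / 2) \<le> - (\<Sum>(t,k)\<in>p2. ?V k)"
    by (intro le_imp_neg_le less_imp_le)
  also have "- (\<Sum>(t,k)\<in>p2. ?V k) \<le> (\<Sum>(t,k)\<in>p2. u (Sup k) - u (Inf k))"
    unfolding sum_negf[symmetric]
  proof (rule sum_mono, clarify)
    fix t k assume "(t, k) \<in> p2"
    then have "k \<noteq> {}" using pD(2) by (auto simp: p2_def)
    then show "- ?V k \<le> u (Sup k) - u (Inf k)"
      using abs_ge_minus_self[of "u (Sup k) - u (Inf k)"] by simp
  qed
  finally have s2: "- (e / 2) \<le> (\<Sum>(t,k)\<in>p2. u (Sup k) - u (Inf k))" .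
  have "u b - u a = (\<Sum>(t,k)\<in>p. u (Sup k) - u (Inf k))"
    by (rule additive_tagged_division_1[OF \<open>a \<le> b\<close> p, symmetric])
  also have "p = p1 \<union> p2" by (auto simp: p1_def p2_def)
  also have "(\<Sum>(t,k)\<in>p1 \<union> p2. u (Sup k) - u (Inf k)) =
      (\<Sum>(t,k)\<in>p1. u (Sup k) - u (Inf k)) + (\<Sum>(t,k)\<in>p2. u (Sup k) - u (Inf k))"
    using fin by (intro sum.union_disjoint) (auto simp: p1_def p2_def)
  finally have "- (\<epsilon> * (b - a)) + - (e / 2) \<le> u b - u a" using add_mono[OF s1 s2] by simp
  moreover have "\<epsilon> * (b - a) \<le> e / 2"
  proof -
    have "\<epsilon> * (b - a) \<le> \<epsilon> * (b - a + 1)" using \<open>\<epsilon> > 0\<close> by simp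
    also have "\<dots> = e / 2" using \<open>a \<le> b\<close> by (simp add: \<epsilon>_def field_simps)
    finally show ?thesis .
  qed
  ultimately show "u a \<le> u b + e" by simp
qed

section \<open>The weighted primitive and local boundedness\<close>

text \<open>An antiderivative \<open>Q\<close> is nondecreasing since the integrand is positive. It
  is bounded below since \<open>b1 / lam * exp (lam * t) - Q t\<close> is nondecreasing as well.
  Hence \<open>Q\<close> tends to its infimum at -\<infinity>, and subtracting the infimum gives
  \<open>P\<close>.\<close>

lemma exp_weighted_primitive_exists:
  fixes b :: "real \<Rightarrow> real"
  assumes "lam > 0" and cont: "continuous_on UNIV b" and b: "\<And>t. 0 < b t" "\<And>t. b t \<le> b1"
  shows "\<exists>P. (\<forall>t. (P has_real_derivative exp (lam * t) * b t) (at t)) \<and> (P \<longlongrightarrow> 0) at_bot"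
proof -
  have "\<exists>Q. \<forall>t. - \<infinity> < ereal t \<longrightarrow> ereal t < \<infinity> \<longrightarrow> (Q has_vector_derivative exp (lam * t) * b t) (at t)"
    using cont by (intro einterval_antiderivative)
      (auto intro!: continuous_intros simp: continuous_on_eq_continuous_at)
  then obtain Q where Q: "\<And>t. (Q has_real_derivative exp (lam * t) * b t) (at t)"
    by (auto simp: has_real_derivative_iff_has_vector_derivative)
  have mono: "Q s \<le> Q t" if "s \<le> t" for s t
    using that Q b(1) by (intro DERIV_nonneg_imp_nondecreasing[of s t Q] exI conjI) (auto simp: less_imp_le)
  have lower: "Q 0 - b1 / lam \<le> Q t" for t
  proof (cases "t \<le> 0")
    case True
    have "b1 / lam * exp (lam * t) - Q t \<le> b1 / lam * exp (lam * 0) - Q 0"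
    proof (intro DERIV_nonneg_imp_nondecreasing[of t 0 "\<lambda>s. b1 / lam * exp (lam * s) - Q s"] True exI conjI)
      fix x
      show "((\<lambda>s. b1 / lam * exp (lam * s) - Q s) has_real_derivative exp (lam * x) * (b1 - b x)) (at x)"
        using \<open>lam > 0\<close> by (auto intro!: derivative_eq_intros Q simp: algebra_simps)
      show "0 \<le> exp (lam * x) * (b1 - b x)" using b(2)[of x] by simp
    qed
    moreover have "b1 > 0" using b[of 0] by linarith
    then have "0 < b1 / lam * exp (lam * t)" using \<open>lam > 0\<close> by simp
    ultimately show ?thesis by simp
  next
    case False
    have "b1 > 0" using b[of 0] by linarith
    then have "b1 / lam > 0" using \<open>lam > 0\<close> by simp
    then show ?thesis using mono[of 0 t] False by linarith
  qed
  have bdd: "bdd_below (range Q)" by (rule bdd_belowI2[OF lower])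
  define P where "P t = Q t - Inf (range Q)" for t
  have "(P has_real_derivative exp (lam * t) * b t) (at t)" for t
    unfolding P_def by (auto intro!: derivative_eq_intros Q)
  moreover have "(P \<longlongrightarrow> 0) at_bot"
  proof (rule decreasing_tendsto)
    show "\<forall>\<^sub>F t in at_bot. 0 \<le> P t" using bdd by (simp add: P_def cInf_lower)
    fix x :: real assume "0 < x"
    then obtain s where "Q s < Inf (range Q) + x"
      using cInf_lessD[of "range Q" "Inf (range Q) + x"] by auto
    then have "P t < x" if "t \<le> s" for t using mono[OF that] by (simp add: P_def)
    then show "\<forall>\<^sub>F t in at_bot. P t < x" by (auto simp: eventually_at_bot_linorder)
  qed
  ultimately show ?thesis by blast
qed

lemma AE_lebesgue_on_mono:
  assumes "AE t in lebesgue_on S. Q t" "T \<subseteq> S" "S \<in> sets lebesgue" "T \<in> sets lebesgue"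
  shows "AE t in lebesgue_on T. Q t"
proof -
  have "AE t in lebesgue. t \<in> S \<longrightarrow> Q t" using assms by (subst (asm) AE_restrict_space_iff) auto
  then have "AE t in lebesgue. t \<in> T \<longrightarrow> Q t" using assms(2) by (auto elim: eventually_mono)
  then show ?thesis using assms by (subst AE_restrict_space_iff) auto
qed

text \<open>A continuous majorant is bounded on compact sets. Asking only Borel measurability of
  \<open>f\<close> admits selections and derivatives with a jump.\<close>

lemma Linf_locI:
  assumes "f \<in> borel_measurable borel" and "continuous_on UNIV g" "\<And>t. \<bar>f t\<bar> \<le> g t"
  shows "Linf_loc \<tau> f"
  unfolding Linf_loc_def
proof (intro conjI allI impI)
  show "f \<in> borel_measurable (lebesgue_on {\<tau>..})"
    using assms(1) by (intro measurable_restrict_space1 measurable_completion) simp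
  fix K :: "real set" assume "compact K \<and> K \<subseteq> {\<tau>..}"
  then have "bounded (g ` K)"
    using assms(2) by (intro compact_imp_bounded compact_continuous_image) (auto intro: continuous_on_subset)
  then obtain C where "\<And>t. t \<in> K \<Longrightarrow> \<bar>g t\<bar> \<le> C" by (auto simp: bounded_iff)
  then have "\<bar>f t\<bar> \<le> C" if "t \<in> K" for t using that assms(3)[of t] by fastforce
  then show "\<exists>C. AE t in lebesgue_on K. \<bar>f t\<bar> \<le> C" by (intro exI[of _ C] AE_I2) simp
qed

section \<open>Solutions of the inclusion: a priori bound and delayed departure from zero\<close>

text \<open>The derivative and the limit at -\<infinity> determine \<open>P\<close>. Keeping it as a
  parameter lets constant forcing supply an explicit exponential.\<close>

locale forced_inclusion =
  fixes lam :: real and b P :: "real \<Rightarrow> real" and b1 :: real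
  assumes lam: "lam > 0"
    and cont: "continuous_on UNIV b"
    and b_pos: "0 < b t" and b_le: "b t \<le> b1"
    and P: "(P has_real_derivative exp (lam * t) * b t) (at t)"
    and P_bot: "(P \<longlongrightarrow> 0) at_bot"
begin

definition xi :: "real \<Rightarrow> real" where "xi t = exp (- (lam * t)) * P t"

lemma P_mono: "s \<le> t \<Longrightarrow> P s \<le> P t"
  using P b_pos by (intro DERIV_nonneg_imp_nondecreasing[of s t P] exI conjI) (auto simp: less_imp_le)

lemma P_strict_mono: "s < t \<Longrightarrow> P s < P t"
  using P b_pos by (intro DERIV_pos_imp_increasing[of s t P] exI conjI) auto

lemma P_nonneg: "0 \<le> P t"
  by (rule tendsto_upperbound[OF P_bot])
     (auto intro: P_mono eventually_mono[OF eventually_le_at_bot[of t]])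

lemma P_pos: "0 < P t"
  using P_nonneg[of "t - 1"] P_strict_mono[of "t - 1" t] by simp

lemma xi_pos: "0 < xi t"
  using P_pos by (simp add: xi_def)

lemma P_cont: "isCont P t"
  using P DERIV_isCont by blast

text \<open>For either sign \<open>\<sigma>\<close>, the function
  \<open>P s + \<sigma> * (exp (lam * s) * u s)\<close> has derivative
  \<open>exp (lam * s) * b s * (1 + \<sigma> * h s)\<close> almost everywhere, nonnegative because
  \<open>\<bar>h s\<bar> \<le> 1\<close>. Being absolutely continuous, it is nondecreasing.\<close>

lemma exp_scaled_solution_increment_le:
  assumes u: "is_solution lam b \<tau> u" and "\<tau> \<le> t"
  shows "\<bar>exp (lam * t) * u t - exp (lam * \<tau>) * u \<tau>\<bar> \<le> P t - P \<tau>"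
proof -
  obtain v h where v: "has_Linf_loc_deriv \<tau> u v"
    and vh: "AE t in lebesgue_on {\<tau>..}. h t \<in> H0 (u t) \<and> v t + lam * u t = b t * h t"
    using u unfolding is_solution_def by blast
  have ac: "abs_continuous_on {\<tau>..t} u"
    and dv: "AE t in lebesgue_on {\<tau>..}. (u has_real_derivative v t) (at t)"
    using v \<open>\<tau> \<le> t\<close> unfolding has_Linf_loc_deriv_def by auto
  have "continuous_on {\<tau>..t} u"
    using u unfolding is_solution_def by (auto intro: continuous_on_subset)
  then have "bounded (u ` {\<tau>..t})" by (intro compact_imp_bounded compact_continuous_image) auto
  then obtain Ub where Ub: "\<And>s. s \<in> {\<tau>..t} \<Longrightarrow> \<bar>u s\<bar> \<le> Ub"
    unfolding bounded_iff real_norm_def by blast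
  have "Ub \<ge> 0" using Ub[of \<tau>] \<open>\<tau> \<le> t\<close> by auto
  have "b1 > 0" using b_pos[of 0] b_le[of 0] by linarith
  have key: "P \<tau> + \<sigma> * (exp (lam * \<tau>) * u \<tau>) \<le> P t + \<sigma> * (exp (lam * t) * u t)"
    if \<sigma>: "\<bar>\<sigma>\<bar> = 1" for \<sigma>
  proof (rule abs_continuous_on_deriv_nonneg_imp_le[OF \<open>\<tau> \<le> t\<close>])
    show "abs_continuous_on {\<tau>..t} (\<lambda>s. P s + \<sigma> * (exp (lam * s) * u s))"
    \<comment> \<open>The first constant bounds the weight on the increments of \<open>u\<close>.
      The second adds a Lipschitz constant of \<open>P\<close> to \<open>Ub\<close> times one of the
      exponential, both from the mean value theorem.\<close>
    proof (rule abs_continuous_on_dominated[OF ac, of "exp (lam * t)" "exp (lam * t) * b1 + Ub * (lam * exp (lam * t))"])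
      fix x y assume xy: "x \<in> {\<tau>..t}" "y \<in> {\<tau>..t}" "x \<le> y"
      have "\<exists>z. x \<le> z \<and> z \<le> y \<and> P y - P x = (y - x) * (exp (lam * z) * b z)"
        using MVT2[of x y P "\<lambda>z. exp (lam * z) * b z"] P xy(3) by (cases "x = y") (auto intro: less_imp_le)
      then obtain z where z: "x \<le> z" "z \<le> y" "P y - P x = (y - x) * (exp (lam * z) * b z)" by blast
      have "exp (lam * z) * b z \<le> exp (lam * t) * b1"
        using z xy lam b_pos[of z] b_le[of z] by (intro mult_mono) auto
      then have 1: "\<bar>P y - P x\<bar> \<le> exp (lam * t) * b1 * (y - x)"
        using z(3) xy(3) b_pos[of z] by (simp add: abs_mult mult.commute mult_left_mono)
      have "\<exists>z. x \<le> z \<and> z \<le> y \<and> exp (lam * y) - exp (lam * x) = (y - x) * (lam * exp (lam * z))"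
      proof (cases "x = y")
        case False
        have "((\<lambda>z. exp (lam * z)) has_real_derivative lam * exp (lam * z)) (at z)" for z
          by (auto intro!: derivative_eq_intros)
        then show ?thesis
          using MVT2[of x y "\<lambda>z. exp (lam * z)" "\<lambda>z. lam * exp (lam * z)"] xy(3) False
          by (auto intro: less_imp_le)
      qed auto
      then obtain z where z: "x \<le> z" "z \<le> y"
        "exp (lam * y) - exp (lam * x) = (y - x) * (lam * exp (lam * z))" by blast
      have "\<bar>exp (lam * y) - exp (lam * x)\<bar> \<le> lam * exp (lam * t) * (y - x)"
        using z xy lam by (auto simp: abs_mult mult.commute intro!: mult_left_mono)
      then have 2: "\<bar>u x\<bar> * \<bar>exp (lam * y) - exp (lam * x)\<bar> \<le> Ub * (lam * exp (lam * t) * (y - x))"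
        using Ub[OF xy(1)] \<open>Ub \<ge> 0\<close> by (intro mult_mono) auto
      have 3: "exp (lam * y) * \<bar>u y - u x\<bar> \<le> exp (lam * t) * \<bar>u y - u x\<bar>"
        using xy lam by (intro mult_right_mono) auto
      have "\<bar>P y + \<sigma> * (exp (lam * y) * u y) - (P x + \<sigma> * (exp (lam * x) * u x))\<bar>
          = \<bar>(P y - P x) + \<sigma> * (exp (lam * y) * (u y - u x) + u x * (exp (lam * y) - exp (lam * x)))\<bar>"
        by (simp add: algebra_simps)
      also have "\<dots> \<le> \<bar>P y - P x\<bar> + (exp (lam * y) * \<bar>u y - u x\<bar> + \<bar>u x\<bar> * \<bar>exp (lam * y) - exp (lam * x)\<bar>)"
        using \<sigma> by (intro order_trans[OF abs_triangle_ineq] add_left_mono)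
          (auto simp: abs_mult intro!: order_trans[OF abs_triangle_ineq])
      finally show "\<bar>P y + \<sigma> * (exp (lam * y) * u y) - (P x + \<sigma> * (exp (lam * x) * u x))\<bar>
          \<le> exp (lam * t) * \<bar>u y - u x\<bar> + (exp (lam * t) * b1 + Ub * (lam * exp (lam * t))) * (y - x)"
        using 1 2 3 by (simp add: algebra_simps)
    qed (use \<open>b1 > 0\<close> \<open>Ub \<ge> 0\<close> lam in auto)
    have "AE s in lebesgue_on {\<tau>..}. \<exists>d\<ge>0. ((\<lambda>s. P s + \<sigma> * (exp (lam * s) * u s)) has_real_derivative d) (at s)"
      using dv vh
    proof eventually_elim
      case (elim s)
      then have h: "\<bar>h s\<bar> \<le> 1" by (auto simp: H0_def split: if_splits)
      have eq: "b s * h s = v s + lam * u s" using elim by simp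
      have "((\<lambda>s. P s + \<sigma> * (exp (lam * s) * u s)) has_real_derivative
          exp (lam * s) * b s + \<sigma> * (exp (lam * s) * (v s + lam * u s))) (at s)"
        using elim(1) by (auto intro!: derivative_eq_intros P simp: algebra_simps)
      moreover have "exp (lam * s) * b s + \<sigma> * (exp (lam * s) * (v s + lam * u s))
          = exp (lam * s) * b s * (1 + \<sigma> * h s)"
        by (simp add: eq[symmetric] algebra_simps)
      moreover have "0 \<le> exp (lam * s) * b s * (1 + \<sigma> * h s)"
      proof -
        have "\<bar>\<sigma> * h s\<bar> \<le> 1" using h \<sigma> by (simp add: abs_mult)
        then have "0 \<le> 1 + \<sigma> * h s" by linarith
        then show ?thesis using b_pos[of s] by simp
      qed
      ultimately show ?case by auto
    qed
    then show "AE s in lebesgue_on {\<tau>..t}. \<exists>d\<ge>0. ((\<lambda>s. P s + \<sigma> * (exp (lam * s) * u s)) has_real_derivative d) (at s)"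
      by (rule AE_lebesgue_on_mono) auto
  qed
  show ?thesis using key[of 1] key[of "-1"] by simp
qed

text \<open>The increment bound is divided by the weight, and \<open>P \<tau> \<ge> 0\<close> is
  dropped. The term with the initial value decays both as \<open>\<tau>\<close> tends to
  -\<infinity> and as \<open>t\<close> tends to \<infinity>, which serves pullback and forward
  limits alike.\<close>

lemma process_bound:
  assumes "y \<in> process lam b t \<tau> x" and "\<tau> \<le> t"
  shows "\<bar>y\<bar> \<le> xi t + \<bar>x\<bar> * exp (lam * (\<tau> - t))"
proof -
  obtain u where u: "is_solution lam b \<tau> u" "u \<tau> = x" "y = u t"
    using assms(1) unfolding process_def by blast
  have "\<bar>exp (lam * t) * u t\<bar> \<le> P t + \<bar>exp (lam * \<tau>) * u \<tau>\<bar>"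
    using exp_scaled_solution_increment_le[OF u(1) assms(2)] P_nonneg[of \<tau>] by linarith
  then have "\<bar>exp (lam * t) * y\<bar> \<le> P t + \<bar>exp (lam * \<tau>) * x\<bar>" using u by simp
  then have "exp (- (lam * t)) * (exp (lam * t) * \<bar>y\<bar>) \<le> exp (- (lam * t)) * (P t + exp (lam * \<tau>) * \<bar>x\<bar>)"
    by (intro mult_left_mono) (auto simp: abs_mult)
  also have "exp (- (lam * t)) * (exp (lam * t) * \<bar>y\<bar>) = \<bar>y\<bar>"
    by (simp add: mult.assoc[symmetric] exp_add[symmetric])
  also have "exp (- (lam * t)) * (P t + exp (lam * \<tau>) * \<bar>x\<bar>) = xi t + \<bar>x\<bar> * exp (lam * (\<tau> - t))"
    by (simp add: xi_def algebra_simps exp_diff exp_minus field_simps)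
  finally show ?thesis .
qed

text \<open>Uniqueness fails at zero: the selection 0 from \<open>H0 0\<close> keeps the solution at
  rest up to \<open>s0\<close>, and the selection \<open>\<sigma>\<close> drives it away afterwards.
  It keeps the sign \<open>\<sigma>\<close> because \<open>P\<close> is strictly increasing. Writing
  \<open>max s0 t\<close> joins the two phases in one formula.\<close>

lemma delayed_solution:
  assumes \<sigma>: "\<sigma> = 1 \<or> \<sigma> = -1"
  shows "is_solution lam b \<tau> (\<lambda>t. \<sigma> * (exp (- (lam * max s0 t)) * (P (max s0 t) - P s0)))"
proof -
  define F where "F t = exp (- (lam * t)) * (P t - P s0)" for t
  define u where "u t = \<sigma> * F (max s0 t)" for t
  define h where "h t = (if s0 < t then \<sigma> else 0)" for t
  \<comment> \<open>Read off from the equation, which then holds by definition; it remains to see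
    that \<open>v\<close> is the derivative of \<open>u\<close> away from the corner at
    \<open>s0\<close>.\<close>
  define v where "v t = b t * h t - lam * u t" for t
  have F0: "F s0 = 0" by (simp add: F_def)
  have Fpos: "F t > 0" if "t > s0" for t using P_strict_mono[OF that] by (simp add: F_def)
  have F': "(F has_real_derivative b t - lam * F t) (at t)" for t
  proof -
    have "(F has_real_derivative exp (- (lam * t)) * (exp (lam * t) * b t) - lam * F t) (at t)"
      unfolding F_def by (rule derivative_eq_intros P refl | simp add: mult_ac)+
    moreover have "exp (- (lam * t)) * (exp (lam * t) * b t) = b t" by (simp add: exp_minus)
    ultimately show ?thesis by metis
  qed
  have Fcont: "continuous_on UNIV F"
    using F' by (meson DERIV_isCont continuous_at_imp_continuous_on)
  have ucont: "continuous_on UNIV u"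
    unfolding u_def by (intro continuous_intros continuous_on_compose2[OF Fcont]) auto
  have hmeas: "h \<in> borel_measurable borel" unfolding h_def by measurable
  have Lh: "Linf_loc \<tau> h"
    by (rule Linf_locI[OF hmeas, of "\<lambda>_. 1"]) (use \<sigma> in \<open>auto simp: h_def\<close>)
  have Lv: "Linf_loc \<tau> v"
  proof (rule Linf_locI)
    show "v \<in> borel_measurable borel"
      unfolding v_def using hmeas cont ucont
      by (intro borel_measurable_diff borel_measurable_times) (auto intro: borel_measurable_continuous_onI)
    show "continuous_on UNIV (\<lambda>t. \<bar>b t\<bar> + lam * \<bar>u t\<bar>)" by (intro continuous_intros cont ucont)
    show "\<bar>v t\<bar> \<le> \<bar>b t\<bar> + lam * \<bar>u t\<bar>" for t
    proof -
      have "\<bar>b t * h t\<bar> \<le> \<bar>b t\<bar>" using \<sigma> by (auto simp: h_def)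
      moreover have "\<bar>lam * u t\<bar> = lam * \<bar>u t\<bar>" using lam by (simp add: abs_mult)
      ultimately show ?thesis unfolding v_def by linarith
    qed
  qed
  have AC: "abs_continuous_on {\<tau>..T} u" for T
  proof -
    \<comment> \<open>The end point \<open>max s0 T\<close> keeps the interval nonempty when
      \<open>T < s0\<close>, so that \<open>C \<ge> 0\<close> follows by evaluating at
      \<open>s0\<close>.\<close>
    have "bounded ((\<lambda>t. b t - lam * F t) ` {s0..max s0 T})"
      by (intro compact_imp_bounded compact_continuous_image continuous_intros
          continuous_on_subset[OF cont] continuous_on_subset[OF Fcont]) auto
    then obtain C where C: "\<And>t. t \<in> {s0..max s0 T} \<Longrightarrow> \<bar>b t - lam * F t\<bar> \<le> C"
      unfolding bounded_iff real_norm_def by blast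
    have "C \<ge> 0" using C[of s0] by auto
    then show ?thesis
    proof (rule lipschitz_imp_abs_continuous_on)
      fix x y assume xy: "x \<in> {\<tau>..T}" "y \<in> {\<tau>..T}" "x \<le> y"
      \<comment> \<open>Truncation at \<open>s0\<close> does not increase distances, so the mean
        value theorem for the smooth \<open>F\<close> suffices and the corner of \<open>u\<close> is
        avoided.\<close>
      define x' y' where "x' = max s0 x" and "y' = max s0 y"
      have "x' \<le> y'" using xy by (auto simp: x'_def y'_def)
      then have "\<exists>z. x' \<le> z \<and> z \<le> y' \<and> F y' - F x' = (y' - x') * (b z - lam * F z)"
        using MVT2[of x' y' F "\<lambda>z. b z - lam * F z"] F' by (cases "x' = y'") (auto intro: less_imp_le)
      then obtain z where z: "x' \<le> z" "z \<le> y'" "F y' - F x' = (y' - x') * (b z - lam * F z)" by blast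
      have "\<bar>u y - u x\<bar> = \<bar>F y' - F x'\<bar>"
        using \<sigma> by (auto simp: u_def x'_def y'_def)
      also have "\<dots> \<le> (y' - x') * C"
        using z C[of z] \<open>x' \<le> y'\<close> xy by (auto simp: abs_mult x'_def y'_def intro!: mult_left_mono)
      also have "\<dots> \<le> (y - x) * C"
        using \<open>C \<ge> 0\<close> xy by (intro mult_right_mono) (auto simp: x'_def y'_def)
      finally show "\<bar>u y - u x\<bar> \<le> C * (y - x)" by (simp add: mult.commute)
    qed
  qed
  have u': "(u has_real_derivative v t) (at t)" if "t \<noteq> s0" for t
  proof (cases "t < s0")
    case True
    have "((\<lambda>_. 0) has_real_derivative v t) (at t)"
      using True by (auto simp: v_def h_def u_def F0)
    then show ?thesis
      by (rule has_field_derivative_transform_within_open[of _ _ _ "{..<s0}"])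
         (use True in \<open>auto simp: u_def F0\<close>)
  next
    case False
    then have "t > s0" using that by simp
    have "((\<lambda>t. \<sigma> * F t) has_real_derivative v t) (at t)"
      using \<open>t > s0\<close> by (auto intro!: derivative_eq_intros F' simp: v_def h_def u_def algebra_simps)
    then show ?thesis
      by (rule has_field_derivative_transform_within_open[of _ _ _ "{s0<..}"])
         (use \<open>t > s0\<close> in \<open>auto simp: u_def\<close>)
  qed
  have "AE t in lebesgue. t \<noteq> s0"
    by (rule AE_I'[of "{s0}"]) auto
  then have "AE t in lebesgue_on {\<tau>..}. (u has_real_derivative v t) (at t)"
    using u' by (subst AE_restrict_space_iff) (auto elim: eventually_mono)
  then have "has_Linf_loc_deriv \<tau> u v"
    using AC Lv by (auto simp: has_Linf_loc_deriv_def)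
  moreover have "h t \<in> H0 (u t)" for t
    using \<sigma> Fpos[of t] F0 by (auto simp: h_def u_def H0_def max_def)
  ultimately have "is_solution lam b \<tau> u"
    using Lh continuous_on_subset[OF ucont subset_UNIV] unfolding is_solution_def
    by (intro conjI exI[of _ v] exI[of _ h] AE_I2) (simp_all add: v_def)
  then show ?thesis by (simp add: u_def[abs_def] F_def)
qed

text \<open>The solution leaves zero at \<open>s0\<close> with the sign of \<open>y\<close>. Since
  \<open>\<tau>\<close> is any time up to \<open>s0\<close>, the same \<open>y\<close> is reached
  from all sufficiently early initial times.\<close>

lemma mem_process_zero:
  assumes "\<tau> \<le> s0" "s0 \<le> t" and y: "exp (- (lam * t)) * (P t - P s0) = \<bar>y\<bar>"
  shows "y \<in> process lam b t \<tau> 0"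
proof -
  \<comment> \<open>\<open>sgn y\<close> would be 0 at \<open>y = 0\<close>, a value excluded in
    \<open>delayed_solution\<close>.\<close>
  define \<sigma> :: real where "\<sigma> = (if y \<ge> 0 then 1 else -1)"
  let ?u = "\<lambda>t. \<sigma> * (exp (- (lam * max s0 t)) * (P (max s0 t) - P s0))"
  have "is_solution lam b \<tau> ?u" by (rule delayed_solution) (auto simp: \<sigma>_def)
  moreover have "?u \<tau> = 0" using assms(1) by (simp add: max_def)
  moreover have "?u t = y" using assms(2) y by (auto simp: \<sigma>_def max_def)
  ultimately show ?thesis unfolding process_def by (auto intro!: exI[of _ ?u])
qed

end

section \<open>Semidistance to closed sets and symmetric intervals\<close>

text \<open>A point outside a closed set has positive distance from it, so its persistent presence
  in \<open>S \<tau>\<close> keeps the semidistance away from 0. The general filter covers limits at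
  both ends of the time axis.\<close>

lemma mem_if_attracted:
  assumes "closed K" and "F \<noteq> bot" and lim: "((\<lambda>\<tau>. semidist (S \<tau>) K) \<longlongrightarrow> 0) F"
    and mem: "\<forall>\<^sub>F \<tau> in F. y \<in> S \<tau>"
  shows "y \<in> K"
proof (rule ccontr)
  assume "y \<notin> K"
  then obtain e where "e > 0" and e: "ball y e \<subseteq> - K"
    using \<open>closed K\<close> open_contains_ball[of "- K"] by (auto simp: open_Compl)
  have far: "ennreal e \<le> semidist (S \<tau>) K" if "y \<in> S \<tau>" for \<tau>
  proof -
    have "ennreal e \<le> ennreal \<bar>y - x\<bar>" if "x \<in> K" for x
    proof -
      have "x \<notin> ball y e" using e that by blast
      then show ?thesis by (auto simp: dist_real_def intro: ennreal_leI)
    qed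
    then have "ennreal e \<le> (INF x\<in>K. ennreal \<bar>y - x\<bar>)" by (rule INF_greatest)
    also have "\<dots> \<le> semidist (S \<tau>) K" unfolding semidist_def using that by (rule SUP_upper)
    finally show ?thesis .
  qed
  have "\<forall>\<^sub>F \<tau> in F. semidist (S \<tau>) K < ennreal e"
    using order_tendstoD(2)[OF lim, of "ennreal e"] \<open>e > 0\<close> by simp
  then have "\<forall>\<^sub>F \<tau> in F. False"
    using mem by eventually_elim (use far in \<open>auto simp: leD\<close>)
  then show False using \<open>F \<noteq> bot\<close> by (simp add: trivial_limit_def)
qed

lemma semidist_symmetric_interval_le:
  assumes "0 \<le> c" "0 \<le> d" and S: "\<And>y. y \<in> S \<Longrightarrow> \<bar>y\<bar> \<le> c + d"
  shows "semidist S {-c..c} \<le> ennreal d"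
  unfolding semidist_def
proof (rule SUP_least)
  fix y assume "y \<in> S"
  \<comment> \<open>The witness is the point of \<open>{-c..c}\<close> nearest to
    \<open>y\<close>.\<close>
  then have "\<bar>y - max (- c) (min c y)\<bar> \<le> d" using S[of y] assms(1,2) by (auto simp: max_def min_def)
  then show "(INF x\<in>{-c..c}. ennreal \<bar>y - x\<bar>) \<le> ennreal d"
    using assms(1) by (intro INF_lower2[of "max (- c) (min c y)"]) (auto intro: ennreal_leI)
qed

lemma hausdorff_dist_symmetric_intervals_le:
  assumes "0 \<le> x" "0 \<le> c"
  shows "hausdorff_dist {-x..x} {-c..c} \<le> ennreal \<bar>x - c\<bar>"
  unfolding hausdorff_dist_def using assms
  by (intro max.boundedI semidist_symmetric_interval_le) auto

text \<open>Solutions starting from zero reach only points strictly inside the limiting interval;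
  the end points enter by closure.\<close>

lemma symmetric_interval_subset_closed:
  fixes r :: real
  assumes "closed K" "0 < r" "\<And>y. \<bar>y\<bar> < r \<Longrightarrow> y \<in> K"
  shows "{-r..r} \<subseteq> K"
proof -
  have "{-r<..<r} \<subseteq> K" using assms(3) by auto
  then have "closure {-r<..<r} \<subseteq> K" using assms(1) by (rule closure_minimal)
  then show ?thesis using assms(2) by simp
qed

section \<open>Identification of the attractors and convergence of the end points\<close>

context forced_inclusion
begin

lemma pullback_attractor_eq:
  assumes "is_pullback_attractor (process lam b) A"
  shows "A t = {- xi t..xi t}"
proof
  have attr: "pullback_attracting (process lam b) A" and "compact (A t)"
    and minimal: "\<And>C. (\<forall>t. closed (C t)) \<Longrightarrow> pullback_attracting (process lam b) C \<Longrightarrow> A t \<subseteq> C t"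
    using assms unfolding is_pullback_attractor_def by blast+
  have "pullback_attracting (process lam b) (\<lambda>t. {- xi t..xi t})"
    unfolding pullback_attracting_def
  proof (intro allI impI)
    fix B :: "real set" and t assume "bounded B"
    then obtain M where M: "\<And>x. x \<in> B \<Longrightarrow> \<bar>x\<bar> \<le> M" unfolding bounded_iff real_norm_def by blast
    \<comment> \<open>The absolute value guards against a negative \<open>M\<close>, possible when
      \<open>B\<close> is empty.\<close>
    have bound: "semidist (\<Union>x\<in>B. process lam b t \<tau> x) {- xi t..xi t} \<le> ennreal (\<bar>M\<bar> * exp (lam * (\<tau> - t)))"
      if "\<tau> \<le> t" for \<tau>
    proof (rule semidist_symmetric_interval_le)
      fix y assume "y \<in> (\<Union>x\<in>B. process lam b t \<tau> x)"
      then obtain x where x: "x \<in> B" "y \<in> process lam b t \<tau> x" by blast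
      have "\<bar>x\<bar> * exp (lam * (\<tau> - t)) \<le> \<bar>M\<bar> * exp (lam * (\<tau> - t))"
        using M[OF x(1)] by (intro mult_right_mono) auto
      then show "\<bar>y\<bar> \<le> xi t + \<bar>M\<bar> * exp (lam * (\<tau> - t))"
        using process_bound[OF x(2) that] by linarith
    qed (use xi_pos[of t] in auto)
    have "filterlim (\<lambda>\<tau>. - t + \<tau>) at_bot at_bot"
      by (subst filterlim_tendsto_add_at_bot_iff[OF tendsto_const]) (rule filterlim_ident)
    then have "filterlim (\<lambda>\<tau>. lam * (\<tau> - t)) at_bot at_bot"
      using lam by (intro filterlim_tendsto_pos_mult_at_bot[OF tendsto_const]) simp_all
    then have "((\<lambda>\<tau>. \<bar>M\<bar> * exp (lam * (\<tau> - t))) \<longlongrightarrow> 0) at_bot"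
      by (intro tendsto_mult_right_zero filterlim_compose[OF exp_at_bot])
    then have lim: "((\<lambda>\<tau>. ennreal (\<bar>M\<bar> * exp (lam * (\<tau> - t)))) \<longlongrightarrow> 0) at_bot"
      using tendsto_ennrealI by force
    show "((\<lambda>\<tau>. semidist (\<Union>x\<in>B. process lam b t \<tau> x) {- xi t..xi t}) \<longlongrightarrow> 0) at_bot"
      by (rule tendsto_sandwich[OF _ _ tendsto_const lim])
         (auto intro: eventually_mono[OF eventually_le_at_bot[of t]] bound)
  qed
  then show "A t \<subseteq> {- xi t..xi t}" by (intro minimal) auto
  show "{- xi t..xi t} \<subseteq> A t"
  proof (rule symmetric_interval_subset_closed)
    show "closed (A t)" using \<open>compact (A t)\<close> by (rule compact_imp_closed)
    fix y assume y: "\<bar>y\<bar> < xi t"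
    \<comment> \<open>The value \<open>P s0\<close> must have for a departure at \<open>s0\<close>
      to reach modulus \<open>\<bar>y\<bar>\<close> at time \<open>t\<close>. It lies in (0,
      \<open>P t\<close>], so the intermediate value theorem yields \<open>s0\<close>.\<close>
    define p where "p = P t - exp (lam * t) * \<bar>y\<bar>"
    have "exp (lam * t) * \<bar>y\<bar> < exp (lam * t) * xi t" using y by simp
    also have "\<dots> = P t" by (simp add: xi_def exp_minus)
    finally have "0 < p" by (simp add: p_def)
    then have "\<forall>\<^sub>F s in at_bot. P s < p \<and> s \<le> t"
      using order_tendstoD(2)[OF P_bot] by (intro eventually_conj eventually_le_at_bot) simp
    then obtain a where "P a < p" "a \<le> t"
      by (metis (no_types, lifting) eventually_happens' trivial_limit_at_bot_linorder)
    then obtain s0 where s0: "a \<le> s0" "s0 \<le> t" "P s0 = p"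
      using IVT[of P a p t] P_cont by (auto simp: p_def)
    have "exp (- (lam * t)) * (P t - P s0) = \<bar>y\<bar>"
      by (simp add: s0(3) p_def exp_minus)
    then have mem: "y \<in> process lam b t \<tau> 0" if "\<tau> \<le> s0" for \<tau>
      using mem_process_zero that s0(2) by blast
    have "((\<lambda>\<tau>. semidist (\<Union>x\<in>{0}. process lam b t \<tau> x) (A t)) \<longlongrightarrow> 0) at_bot"
      using attr unfolding pullback_attracting_def by blast
    then show "y \<in> A t"
    proof (rule mem_if_attracted[OF \<open>closed (A t)\<close>, rotated])
      show "\<forall>\<^sub>F \<tau> in at_bot. y \<in> (\<Union>x\<in>{0}. process lam b t \<tau> x)"
        by (auto intro: eventually_mono[OF eventually_le_at_bot[of s0]] mem)
    qed simp
  qed (rule xi_pos)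
qed

lemma xi_tendsto:
  assumes "(b \<longlongrightarrow> \<beta>) at_top"
  shows "(xi \<longlongrightarrow> \<beta> / lam) at_top"
proof -
  have "((\<lambda>t. P t / exp (lam * t)) \<longlongrightarrow> \<beta> / lam) at_top"
  proof (rule lhospital_at_top_at_top)
    have "filterlim (\<lambda>t. lam * t) at_top at_top"
      using lam by (intro filterlim_tendsto_pos_mult_at_top[OF tendsto_const _ filterlim_ident])
    then show "filterlim (\<lambda>t. exp (lam * t)) at_top at_top"
      by (rule filterlim_compose[OF exp_at_top])
    show "\<forall>\<^sub>F t in at_top. ((\<lambda>t. exp (lam * t)) has_real_derivative lam * exp (lam * t)) (at t)"
      by (auto intro!: derivative_eq_intros always_eventually)
    \<comment> \<open>The exponentials cancel, leaving \<open>b t / lam\<close>.\<close>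
    show "((\<lambda>t. exp (lam * t) * b t / (lam * exp (lam * t))) \<longlongrightarrow> \<beta> / lam) at_top"
      using assms lam by (auto intro!: tendsto_intros)
  qed (use P lam in auto)
  then show ?thesis by (simp add: xi_def[abs_def] exp_minus field_simps)
qed

end

text \<open>For constant forcing \<open>xi\<close> is the constant \<open>\<beta> / lam\<close>. The
  upper inclusion rests on negative invariance instead of minimality: a point of \<open>A\<close>
  has an ancestor in the bounded set \<open>A\<close> arbitrarily long ago, whose influence decays
  exponentially. The lower one uses attraction of \<open>{0}\<close>.\<close>

lemma global_attractor_eq:
  assumes lam: "lam > 0" and "\<beta> > 0" and A: "is_global_attractor (semiflow lam \<beta>) A"
  shows "A = {- (\<beta> / lam)..\<beta> / lam}"
proof
  define c where "c = \<beta> / lam"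
  have "c > 0" using lam \<open>\<beta> > 0\<close> by (simp add: c_def)
  have lc: "lam * c = \<beta>" using lam by (simp add: c_def)
  interpret forced_inclusion lam "\<lambda>_. \<beta>" "\<lambda>t. c * exp (lam * t)" \<beta>
  proof
    show "((\<lambda>t. c * exp (lam * t)) has_real_derivative exp (lam * t) * \<beta>) (at t)" for t
      by (auto intro!: derivative_eq_intros simp: lc[symmetric])
    have "filterlim (\<lambda>t. lam * t) at_bot at_bot"
      using lam by (intro filterlim_tendsto_pos_mult_at_bot[OF tendsto_const _ filterlim_ident])
    then show "((\<lambda>t. c * exp (lam * t)) \<longlongrightarrow> 0) at_bot"
      by (intro tendsto_mult_right_zero filterlim_compose[OF exp_at_bot])
  qed (use lam \<open>\<beta> > 0\<close> in auto)
  have xi: "xi t = c" for t by (simp add: xi_def exp_minus)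
  have sf: "semiflow lam \<beta> t x = process lam (\<lambda>_. \<beta>) t 0 x" for t x
    by (simp add: semiflow_def process_def)
  have "compact A" and inv: "\<And>t. t \<ge> 0 \<Longrightarrow> A \<subseteq> (\<Union>x\<in>A. semiflow lam \<beta> t x)"
    and attr: "\<And>B. bounded B \<Longrightarrow> ((\<lambda>t. semidist (\<Union>x\<in>B. semiflow lam \<beta> t x) A) \<longlongrightarrow> 0) at_top"
    using A unfolding is_global_attractor_def by blast+
  show "A \<subseteq> {- (\<beta> / lam)..\<beta> / lam}"
  proof
    fix y assume "y \<in> A"
    obtain M where M: "\<And>x. x \<in> A \<Longrightarrow> \<bar>x\<bar> \<le> M"
      using compact_imp_bounded[OF \<open>compact A\<close>] unfolding bounded_iff real_norm_def by blast
    have bound: "\<bar>y\<bar> \<le> c + M * exp (- (lam * t))" if "t \<ge> 0" for t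
    proof -
      have "y \<in> (\<Union>x\<in>A. semiflow lam \<beta> t x)" using inv[OF that] \<open>y \<in> A\<close> by blast
      then obtain x where x: "x \<in> A" "y \<in> process lam (\<lambda>_. \<beta>) t 0 x"
        by (auto simp: sf)
      have "\<bar>x\<bar> * exp (- (lam * t)) \<le> M * exp (- (lam * t))"
        using M[OF x(1)] by (intro mult_right_mono) auto
      moreover have "\<bar>y\<bar> \<le> c + \<bar>x\<bar> * exp (- (lam * t))"
        using process_bound[OF x(2) that] by (simp add: xi)
      ultimately show ?thesis by linarith
    qed
    have "filterlim (\<lambda>t. - lam * t) at_bot at_top"
      using lam by (intro filterlim_tendsto_neg_mult_at_bot[OF tendsto_const _ filterlim_ident]) simp
    then have "((\<lambda>t. c + M * exp (- lam * t)) \<longlongrightarrow> c + 0) at_top"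
      by (intro tendsto_add tendsto_const tendsto_mult_right_zero filterlim_compose[OF exp_at_bot])
    then have "((\<lambda>t. c + M * exp (- (lam * t))) \<longlongrightarrow> c) at_top" by simp
    then have "\<bar>y\<bar> \<le> c"
      by (rule tendsto_lowerbound)
         (auto intro: eventually_mono[OF eventually_ge_at_top[of 0]] bound)
    then show "y \<in> {- (\<beta> / lam)..\<beta> / lam}" by (auto simp flip: c_def)
  qed
  show "{- (\<beta> / lam)..\<beta> / lam} \<subseteq> A"
    unfolding c_def[symmetric]
  proof (rule symmetric_interval_subset_closed[OF _ \<open>c > 0\<close>])
    show "closed A" using \<open>compact A\<close> by (rule compact_imp_closed)
    fix y assume y: "\<bar>y\<bar> < c"
    \<comment> \<open>Departure from zero at time \<open>t + l\<close> leads to modulus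
      \<open>\<bar>y\<bar>\<close> at time \<open>t\<close>. The conditions \<open>l \<le> 0\<close>
      and \<open>t \<ge> - l\<close> place this departure between 0 and \<open>t\<close>.\<close>
    define l where "l = ln (1 - \<bar>y\<bar> / c) / lam"
    have pos: "0 < 1 - \<bar>y\<bar> / c" using y \<open>c > 0\<close> by simp
    have "l \<le> 0" using pos lam \<open>c > 0\<close> by (simp add: l_def divide_nonpos_pos)
    have exp_l: "exp (lam * l) = 1 - \<bar>y\<bar> / c" using pos lam by (simp add: l_def)
    have mem: "y \<in> semiflow lam \<beta> t 0" if "t \<ge> - l" for t
      unfolding sf
    proof (rule mem_process_zero)
      have "c * exp (lam * (t + l)) = c * exp (lam * t) * (1 - \<bar>y\<bar> / c)"
        by (simp add: distrib_left exp_add exp_l)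
      also have "\<dots> = c * exp (lam * t) - exp (lam * t) * \<bar>y\<bar>"
        using \<open>c > 0\<close> by (simp add: field_simps)
      finally show "exp (- (lam * t)) * (c * exp (lam * t) - c * exp (lam * (t + l))) = \<bar>y\<bar>"
        by (simp add: exp_minus)
    qed (use that \<open>l \<le> 0\<close> in auto)
    have "((\<lambda>t. semidist (\<Union>x\<in>{0}. semiflow lam \<beta> t x) A) \<longlongrightarrow> 0) at_top"
      by (rule attr) simp
    then show "y \<in> A"
    proof (rule mem_if_attracted[OF \<open>closed A\<close>, rotated])
      show "\<forall>\<^sub>F t in at_top. y \<in> (\<Union>x\<in>{0}. semiflow lam \<beta> t x)"
        by (auto intro: eventually_mono[OF eventually_ge_at_top[of "- l"]] mem)
    qed simp
  qed
qed

theorem lemma39: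
  fixes lam b0 b1 b_inf :: real
    and b :: "real \<Rightarrow> real"
    and A :: "real \<Rightarrow> real set"
    and A_inf :: "real set"
  assumes "lam > 0"
    and "continuous_on UNIV b"
    and "0 < b0"
    and "\<And>t. b0 \<le> b t \<and> b t \<le> b1"
    and "b_inf \<in> {b0..b1}"
    and "(b \<longlongrightarrow> b_inf) at_top"
    and "is_pullback_attractor (process lam b) A"
    and "is_global_attractor (semiflow lam b_inf) A_inf"
  shows "((\<lambda>t. hausdorff_dist (A t) A_inf) \<longlongrightarrow> 0) at_top"
proof -
  have b: "0 < b t" "b t \<le> b1" for t using assms(3) assms(4)[of t] by auto
  obtain P where "\<And>t. (P has_real_derivative exp (lam * t) * b t) (at t)" "(P \<longlongrightarrow> 0) at_bot"
    using exp_weighted_primitive_exists[OF assms(1,2) b] by blast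
  then interpret forced_inclusion lam b P b1
    using assms(1,2) b by unfold_locales
  define c where "c = b_inf / lam"
  have "b_inf > 0" using assms(3,5) by auto
  then have "c > 0" and A_inf: "A_inf = {-c..c}"
    using global_attractor_eq[OF assms(1) _ assms(8)] assms(1) by (simp_all add: c_def)
  have "((\<lambda>t. \<bar>xi t - c\<bar>) \<longlongrightarrow> \<bar>c - c\<bar>) at_top"
    unfolding c_def by (intro tendsto_intros xi_tendsto assms(6))
  then have lim: "((\<lambda>t. ennreal \<bar>xi t - c\<bar>) \<longlongrightarrow> 0) at_top"
    using tendsto_ennrealI by force
  \<comment> \<open>Both attractors are intervals centred at 0, so the gap between their right end
    points controls the distance.\<close>
  have "hausdorff_dist (A t) A_inf \<le> ennreal \<bar>xi t - c\<bar>" for t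
    unfolding pullback_attractor_eq[OF assms(7)] A_inf
    using xi_pos[of t] \<open>c > 0\<close> by (intro hausdorff_dist_symmetric_intervals_le) auto
  then show ?thesis
    by (intro tendsto_sandwich[OF _ _ tendsto_const lim]) auto
qed

end
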